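(* Let $G$ be a connected graph with at least $2$ vertices and $H$ a connected graph. Then \[F(G+_R H)=8|V(H)|F(G)+|V(G)|F(H)+24|E(H)|M_1(G)+12|E(G)|M_1(H)+8|V(H)||E(G)|.\]
   Context: All graphs are finite, simple and undirected; $d_G(v)$ denotes degree. $F(G)=\sum_{v\in V(G)}d_G(v)^3$ and $M_1(G)=\sum_{v\in V(G)}d_G(v)^2$. The triangle parallel graph $R(G)$ has vertex set $V(G)\cup E(G)$ and is obtained from $G$ by replacing each edge by a triangle: for each edge $e=uv$ the vertex $e$ is adjacent to $u$ and $v$, and the edge $uv$ is kept. The $R$-sum $G+_R H$ is the graph with vertex set $(V(G)\cup E(G))\times V(H)$ in which $(u,v)$ and $(u',v')$ are adjacent if and only if [$u=u'\in V(G)$ and $vv'\in E(H)$] or [$v=v'$ and $uu'\in E(R(G))$]. *)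

theory Defs
  imports "Graph_Theory.Graph_Theory"
begin

text \<open>
  A finite simple undirected graph is a \<^locale>\<open>pair_graph\<close>: a finite, loop-free, symmetric
  set of arcs \<^term>\<open>(u, v)\<close>. Each undirected edge occurs as two opposite arcs, so the edges
  themselves are recovered as the two-element sets of endpoints, and the undirected degree of a
  vertex is its out-degree.
\<close>

definition uedges :: "'a pair_pre_digraph \<Rightarrow> 'a set set" where
  "uedges G = {{u, v} | u v. (u, v) \<in> parcs G}"

definition deg :: "'a pair_pre_digraph \<Rightarrow> 'a \<Rightarrow> nat" where
  "deg G v = out_degree (with_proj G) v"

definition forgotten_index :: "'a pair_pre_digraph \<Rightarrow> nat" where
  "forgotten_index G = (\<Sum>v\<in>pverts G. deg G v ^ 3)"

definition first_zagreb_index :: "'a pair_pre_digraph \<Rightarrow> nat" where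
  "first_zagreb_index G = (\<Sum>v\<in>pverts G. deg G v ^ 2)"

definition triangle_parallel :: "'a pair_pre_digraph \<Rightarrow> ('a + 'a set) pair_pre_digraph" where
  "triangle_parallel G =
    \<lparr> pverts = pverts G <+> uedges G,
      parcs = {(Inl u, Inl v) | u v. (u, v) \<in> parcs G}
            \<union> {(Inl u, Inr e) | u e. e \<in> uedges G \<and> u \<in> e}
            \<union> {(Inr e, Inl u) | u e. e \<in> uedges G \<and> u \<in> e} \<rparr>"

definition R_sum ::
    "'a pair_pre_digraph \<Rightarrow> 'b pair_pre_digraph \<Rightarrow> (('a + 'a set) \<times> 'b) pair_pre_digraph" where
  "R_sum G H =
    \<lparr> pverts = (pverts G <+> uedges G) \<times> pverts H,
      parcs = {((x, v), (x', v')) | x v x' v'.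
          (x, v) \<in> (pverts G <+> uedges G) \<times> pverts H \<and>
          (x', v') \<in> (pverts G <+> uedges G) \<times> pverts H \<and>
          (x = x' \<and> x \<in> Inl ` pverts G \<and> (v, v') \<in> parcs H \<or>
           v = v' \<and> (x, x') \<in> parcs (triangle_parallel G))} \<rparr>"

lemma (in pair_graph) finite_uedges: "finite (uedges G)"
proof -
  have "uedges G = (\<lambda>(u, v). {u, v}) ` parcs G"
    by (auto simp: uedges_def image_iff)
  then show ?thesis by simp
qed

lemma (in pair_graph) uedges_subset: "e \<in> uedges G \<Longrightarrow> e \<subseteq> pverts G"
  by (auto simp: uedges_def dest: in_arcsD1 in_arcsD2)

lemma (in pair_graph) card_uedge: "e \<in> uedges G \<Longrightarrow> card e = 2"
  by (auto simp: uedges_def dest: pair_no_loops)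

lemma (in pair_graph) deg_eq_card_neighbours: "deg G v = card {w. {v, w} \<in> uedges G}"
proof -
  have "{w. {v, w} \<in> uedges G} = {w. (v, w) \<in> parcs G}"
    using pair_sym_arcs by (auto simp: uedges_def doubleton_eq_iff symmetric_def dest: symD)
  moreover have "out_arcs (with_proj G) v = Pair v ` {w. (v, w) \<in> parcs G}"
    by (auto simp: out_arcs_def)
  ultimately show ?thesis
    by (simp add: deg_def out_degree_def card_image inj_on_def)
qed

lemma pair_graph_triangle_parallel:
  assumes "pair_graph G"
  shows "pair_graph (triangle_parallel G)"
proof -
  interpret G: pair_graph G by fact
  let ?R = "triangle_parallel G"
  have sub: "parcs ?R \<subseteq> pverts ?R \<times> pverts ?R"
    using G.uedges_subset by (auto simp: triangle_parallel_def dest: G.in_arcsD1 G.in_arcsD2)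
  have fin: "finite (pverts ?R)"
    using G.finite_uedges by (simp add: triangle_parallel_def)
  show ?thesis
  proof
    show "finite (parcs ?R)" using sub fin by (meson finite_SigmaI finite_subset)
    show "symmetric (with_proj ?R)"
      using G.pair_sym_arcs
      by (auto simp: triangle_parallel_def symmetric_def sym_def)
    show "fst e \<noteq> snd e" if "e \<in> parcs ?R" for e
      using that by (auto simp: triangle_parallel_def dest: G.pair_no_loops)
  qed (use sub fin in auto)
qed

lemma pair_graph_R_sum:
  assumes "pair_graph G" "pair_graph H"
  shows "pair_graph (R_sum G H)"
proof -
  interpret G: pair_graph G by fact
  interpret H: pair_graph H by fact
  interpret R: pair_graph "triangle_parallel G"
    using assms(1) by (rule pair_graph_triangle_parallel)
  let ?S = "R_sum G H"
  have sub: "parcs ?S \<subseteq> pverts ?S \<times> pverts ?S"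
    unfolding R_sum_def by auto
  have fin: "finite (pverts ?S)"
    using G.finite_uedges by (simp add: R_sum_def)
  show ?thesis
  proof
    show "finite (parcs ?S)" using sub fin by (meson finite_SigmaI finite_subset)
    show "symmetric (with_proj ?S)"
      using H.pair_sym_arcs R.pair_sym_arcs
      unfolding symmetric_def sym_def with_proj_simps R_sum_def by (simp; blast)
    show "fst e \<noteq> snd e" if "e \<in> parcs ?S" for e
      using that by (auto simp: R_sum_def dest: H.pair_no_loops R.pair_no_loops)
  qed (use sub fin in auto)
qed

end

theory Submission
  imports Defs
begin

text \<open>
  A vertex \<open>(u, v)\<close> with \<open>u \<in> V(G)\<close> has degree \<open>2 d\<^sub>G(u) + d\<^sub>H(v)\<close> in the R-sum, and a vertex
  \<open>(e, v)\<close> with \<open>e \<in> E(G)\<close> has degree \<open>2\<close>. Expanding the cube and summing, the mixed terms are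
  evaluated by the handshake lemma in \<open>H\<close> and in \<open>G\<close>.
\<close>

lemma deg_eq_card_out: "deg G v = card {w. (v, w) \<in> parcs G}"
proof -
  have "out_arcs (with_proj G) v = Pair v ` {w. (v, w) \<in> parcs G}"
    by (auto simp: out_arcs_def)
  then show ?thesis
    by (simp add: deg_def out_degree_def card_image inj_on_def)
qed

lemma (in pair_graph) finite_out_neighbours: "finite {w. (v, w) \<in> parcs G}"
  by (rule finite_subset[of _ "pverts G"]) (auto dest: in_arcsD2)

text \<open>Sending a neighbour \<open>w\<close> to the edge \<open>{v, w}\<close> is a bijection
  onto the edges at \<open>v\<close>. This form of the degree counts the edge-vertices next to
  \<open>Inl u\<close> and drives the handshake lemma.\<close>

lemma (in pair_graph) deg_eq_card_incident: "deg G v = card {e \<in> uedges G. v \<in> e}"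
proof -
  have "{e \<in> uedges G. v \<in> e} = (\<lambda>w. {v, w}) ` {w. (v, w) \<in> parcs G}"
    using pair_sym_arcs by (auto simp: uedges_def symmetric_def insert_commute dest: symD)
  moreover have "inj_on (\<lambda>w. {v, w}) {w. (v, w) \<in> parcs G}"
    by (auto simp: inj_on_def doubleton_eq_iff)
  ultimately show ?thesis
    by (simp add: deg_eq_card_out card_image)
qed

text \<open>Handshake lemma: count the incident pairs of a vertex and an edge in both orders; each
  edge has exactly two ends.\<close>

lemma (in pair_graph) sum_deg: "(\<Sum>v\<in>pverts G. deg G v) = 2 * card (uedges G)"
proof -
  have "card {v \<in> pverts G. v \<in> e} = 2" if "e \<in> uedges G" for e
  proof -
    have "{v \<in> pverts G. v \<in> e} = e" using uedges_subset[OF that] by auto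
    then show ?thesis using card_uedge[OF that] by simp
  qed
  then show ?thesis
    unfolding deg_eq_card_incident
    by (intro sum_multicount) (use finite_uedges in auto)
qed

text \<open>The old neighbours of \<open>u\<close> and the edges at \<open>u\<close> each contribute
  \<open>deg G u\<close>.\<close>

lemma (in pair_graph) deg_triangle_parallel_Inl: "deg (triangle_parallel G) (Inl u) = 2 * deg G u"
proof -
  have "{x. (Inl u, x) \<in> parcs (triangle_parallel G)} =
      {w. (u, w) \<in> parcs G} <+> {e \<in> uedges G. u \<in> e}"
    by (auto simp: triangle_parallel_def)
  moreover have "finite {e \<in> uedges G. u \<in> e}"
    using finite_uedges by simp
  ultimately show ?thesis
    using finite_out_neighbours[of u]
    by (simp add: deg_eq_card_out[of "triangle_parallel G"] card_Plus
        flip: deg_eq_card_out[of G] deg_eq_card_incident)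
qed

lemma (in pair_graph) deg_triangle_parallel_Inr:
  assumes "e \<in> uedges G"
  shows "deg (triangle_parallel G) (Inr e) = 2"
proof -
  have "{x. (Inr e, x) \<in> parcs (triangle_parallel G)} = Inl ` e"
    using assms by (auto simp: triangle_parallel_def)
  then show ?thesis
    using card_uedge[OF assms] by (simp add: deg_eq_card_out card_image)
qed

text \<open>Every arc at \<open>(x, v)\<close> changes exactly one coordinate: it follows
  \<open>triangle_parallel G\<close> in the first, giving \<open>?A\<close>, or \<open>H\<close> in
  the second, giving \<open>?B\<close>. The latter happens only over original vertices of
  \<open>G\<close>.\<close>

lemma deg_R_sum:
  assumes "pair_graph G" "pair_graph H"
    and x: "x \<in> pverts G <+> uedges G" and v: "v \<in> pverts H"
  shows "deg (R_sum G H) (x, v) =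
      deg (triangle_parallel G) x + (if x \<in> Inl ` pverts G then deg H v else 0)"
proof -
  interpret H: pair_graph H by fact
  interpret R: pair_graph "triangle_parallel G"
    using assms(1) by (rule pair_graph_triangle_parallel)
  let ?A = "(\<lambda>x'. (x', v)) ` {x'. (x, x') \<in> parcs (triangle_parallel G)}"
  let ?B = "Pair x ` {v'. x \<in> Inl ` pverts G \<and> (v, v') \<in> parcs H}"
  have R: "x' \<in> pverts G <+> uedges G" if "(x, x') \<in> parcs (triangle_parallel G)" for x'
    using R.in_arcsD2[OF that] by (simp add: triangle_parallel_def)
  have "{y. ((x, v), y) \<in> parcs (R_sum G H)} = ?A \<union> ?B"
    using x v R by (auto simp: R_sum_def simp del: Plus_def dest: H.in_arcsD2)
  \<comment> \<open>A common element would have first coordinate \<open>x\<close>, hence give a loop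
    at \<open>x\<close> in \<open>triangle_parallel G\<close>.\<close>
  moreover have "?A \<inter> ?B = {}"
    by (auto dest: R.pair_no_loops)
  moreover have "finite ?A" "finite ?B"
    using R.finite_out_neighbours H.finite_out_neighbours by simp_all
  ultimately have "deg (R_sum G H) (x, v) = card ?A + card ?B"
    by (simp add: deg_eq_card_out card_Un_disjoint)
  then show ?thesis
    by (simp add: deg_eq_card_out card_image inj_on_def)
qed

theorem theorem3:
  fixes G :: "'a pair_pre_digraph" and H :: "'b pair_pre_digraph"
  assumes "pair_graph G" and "connected (with_proj G)" and "card (pverts G) \<ge> 2"
    and "pair_graph H" and "connected (with_proj H)"
  shows "forgotten_index (R_sum G H) =
      8 * card (pverts H) * forgotten_index G
    + card (pverts G) * forgotten_index H
    + 24 * card (uedges H) * first_zagreb_index G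
    + 12 * card (uedges G) * first_zagreb_index H
    + 8 * card (pverts H) * card (uedges G)"
proof -
  interpret G: pair_graph G by fact
  interpret H: pair_graph H by fact
  note deg_sum = deg_R_sum[OF assms(1,4)]
  let ?f = "\<lambda>x v. deg (R_sum G H) (x, v) ^ 3"
  have "forgotten_index (R_sum G H) = (\<Sum>x\<in>pverts G <+> uedges G. \<Sum>v\<in>pverts H. ?f x v)"
    by (simp add: forgotten_index_def sum.cartesian_product) (simp add: R_sum_def)
  also have "\<dots> = (\<Sum>u\<in>pverts G. \<Sum>v\<in>pverts H. ?f (Inl u) v)
      + (\<Sum>e\<in>uedges G. \<Sum>v\<in>pverts H. ?f (Inr e) v)"
    using G.finite_uedges by (simp add: sum.Plus)
  also have "(\<Sum>e\<in>uedges G. \<Sum>v\<in>pverts H. ?f (Inr e) v) = 8 * card (pverts H) * card (uedges G)"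
  proof -
    \<comment> \<open>Here \<open>H\<close> adds nothing to the degree, so the cube is 2^3.\<close>
    have "?f (Inr e) v = 8" if "e \<in> uedges G" "v \<in> pverts H" for e v
      using that deg_sum[OF InrI] by (simp add: G.deg_triangle_parallel_Inr image_iff)
    then show ?thesis by simp
  qed
  \<comment> \<open>The summand is the binomial expansion of (2a + b)^3 with a =
    \<open>deg G u\<close> and b = \<open>deg H v\<close>.\<close>
  also have "(\<Sum>u\<in>pverts G. \<Sum>v\<in>pverts H. ?f (Inl u) v) =
      (\<Sum>u\<in>pverts G. \<Sum>v\<in>pverts H. 8 * deg G u ^ 3 + deg H v ^ 3
        + 12 * (deg G u ^ 2 * deg H v) + 6 * (deg G u * deg H v ^ 2))"
  proof (intro sum.cong refl)
    fix u v assume "u \<in> pverts G" "v \<in> pverts H"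
    then have "deg (R_sum G H) (Inl u, v) = 2 * deg G u + deg H v"
      using deg_sum[OF InlI] by (simp add: G.deg_triangle_parallel_Inl)
    then show "?f (Inl u) v = 8 * deg G u ^ 3 + deg H v ^ 3
        + 12 * (deg G u ^ 2 * deg H v) + 6 * (deg G u * deg H v ^ 2)"
      by (simp add: power2_eq_square power3_eq_cube algebra_simps)
  qed
  \<comment> \<open>A pure cube is constant in the other variable, which yields the factor
    \<open>card\<close>; a mixed term factors into a sum over \<open>G\<close> times a sum over
    \<open>H\<close>.\<close>
  also have "\<dots> = 8 * card (pverts H) * forgotten_index G + card (pverts G) * forgotten_index H
      + 12 * (first_zagreb_index G * (\<Sum>v\<in>pverts H. deg H v))
      + 6 * ((\<Sum>u\<in>pverts G. deg G u) * first_zagreb_index H)"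
    by (simp add: sum.distrib forgotten_index_def first_zagreb_index_def sum_product
        flip: sum_distrib_left)
  \<comment> \<open>The handshake lemma doubles the coefficients 12 and 6 to 24 and 12.\<close>
  finally show ?thesis
    by (simp add: G.sum_deg H.sum_deg)
qed

end
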